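(* Let $a\in(0,1)$, points $\mathbf p_0^*,\mathbf p_1^*\in\mathbb C$, nonzero tangent vectors $\mathbf d_0,\mathbf d_1\in\mathbb C$ and curvature values $\kappa_0,\kappa_1\in\mathbb R$ be given. Put $\omega_k=\arg\mathbf d_k\in(-\pi,\pi]$ and assume $\omega_0,\omega_1\neq\pi$. A curve $\mathbf r$ of the class of clamped quintic Pythagorean-Hodograph B-spline curves over $\rho=\{\langle0\rangle^6,\langle a\rangle^3,\langle1\rangle^6\}$ (see context) satisfies $$\mathbf r(0)=\mathbf p_0^*,\quad \mathbf r(1)=\mathbf p_1^*,\quad \mathbf r'(0)=\mathbf d_0,\quad \mathbf r'(1)=\mathbf d_1,\quad \kappa(0)=\kappa_0,\quad \kappa(1)=\kappa_1$$ if and only if $\mathbf r$ is the curve with $\mathbf r_0=\mathbf p_0^*$ obtained from complex coefficients $\mathbf z_k=u_k+\mathrm i v_k$, $k=0,\dots,3$, such that $$\mathbf z_0=|\mathbf d_0|^{1/2}e^{\mathrm i\omega_0/2},\qquad \mathbf z_3=|\mathbf d_1|^{1/2}e^{\mathrm i\omega_1/2}\ \text{ or }\ \mathbf z_3=-|\mathbf d_1|^{1/2}e^{\mathrm i\omega_1/2},$$ $$v_1=\frac1{u_0}\Big(u_1v_0+\frac a4\kappa_0(u_0^2+v_0^2)^2\Big),\qquad v_2=\frac1{u_3}\Big(u_2v_3-\frac{1-a}4\kappa_1(u_3^2+v_3^2)^2\Big),$$ and $(u_1,u_2)\in\mathbb R^2$ is a solution of the system of two real quadratic equations in $u_1,u_2$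 given by the real and imaginary parts of $$\mathbf p_1^*-\mathbf p_0^*-\tfrac{1-a}5\mathbf d_1-\tfrac a5\mathbf d_0=\tfrac15\big(1-\tfrac a3\big)\mathbf z_1^2+\tfrac1{15}(2+a)\mathbf z_2^2+\tfrac15\mathbf z_1\mathbf z_2+\tfrac1{15}(1-a)^2\mathbf z_1\mathbf z_3+\tfrac1{15}a(4-a)\mathbf z_0\mathbf z_1+\tfrac1{15}(3-2a-a^2)\mathbf z_2\mathbf z_3+\tfrac1{15}a^2\mathbf z_0\mathbf z_2,$$ in which $\mathbf z_1=u_1+\frac{\mathrm i}{u_0}\big(u_1v_0+\frac a4\kappa_0(u_0^2+v_0^2)^2\big)$ and $\mathbf z_2=u_2+\frac{\mathrm i}{u_3}\big(u_2v_3-\frac{1-a}4\kappa_1(u_3^2+v_3^2)^2\big)$.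
   Context: Points of $\mathbb R^2$ are identified with complex numbers; $\langle t\rangle^k$ denotes the knot $t$ repeated $k$ times. Normalized B-splines: for a nondecreasing knot sequence $\mu=\{t_i\}$, $N^0_{i,\mu}(t)=1$ if $t\in[t_i,t_{i+1})$ and $0$ otherwise, and $N^n_{i,\mu}(t)=\frac{t-t_i}{t_{i+n}-t_i}N^{n-1}_{i,\mu}(t)+\frac{t_{i+n+1}-t}{t_{i+n+1}-t_{i+1}}N^{n-1}_{i+1,\mu}(t)$ with $0/0=0$; at the right end of the domain, values are left limits. The class of curves: for $\mathbf z_0,\dots,\mathbf z_3,\mathbf r_0\in\mathbb C$, let $\mathbf z(t)=\sum_{i=0}^3\mathbf z_iN^2_{i,\mu}(t)$ over $\mu=\{0,0,0,a,1,1,1\}$, and let $\mathbf r:[0,1]\to\mathbb C$ be the curve with $\mathbf r(0)=\mathbf r_0$ and $\mathbf r'=\mathbf z^2$; it is the quintic B-spline curve $\mathbf r(t)=\sum_{i=0}^8\mathbf r_iN^5_{i,\rho}(t)$ with first control point $\mathbf r_0$. The signed curvature of $\mathbf r$ where $\mathbf z(t)\ne0$ is $\kappa(t)=2\,\mathrm{Im}(\overline{\mathbf z(t)}\,\mathbf z'(t))/|\mathbf z(t)|^4$ (one-sided derivatives at the endpoints). *)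

theory Defs
  imports "HOL-Analysis.Analysis"
begin

text \<open>Normalized B-splines over a finite knot list.  In the recursion a vanishing knot difference
  contributes 0, because \<open>x / 0 = 0\<close> in HOL; this is the convention \<open>0/0 = 0\<close>.  Only indices with
  \<open>i + n + 1 < length T\<close> are meaningful.\<close>

fun bspline_rec :: "real list \<Rightarrow> nat \<Rightarrow> nat \<Rightarrow> real \<Rightarrow> real" where
  "bspline_rec T 0 i t = (if T ! i \<le> t \<and> t < T ! (i + 1) then 1 else 0)"
| "bspline_rec T (Suc n) i t =
     (t - T ! i) / (T ! (i + Suc n) - T ! i) * bspline_rec T n i t
   + (T ! (i + Suc n + 1) - t) / (T ! (i + Suc n + 1) - T ! (i + 1)) * bspline_rec T n (i + 1) t"

text \<open>With half-open intervals every spline of the recursion vanishes at the last knot, which is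
  the right end of the domain for clamped knots; there the left limit is taken.\<close>

definition bspline :: "real list \<Rightarrow> nat \<Rightarrow> nat \<Rightarrow> real \<Rightarrow> real" where
  "bspline T n i t =
     (if t = last T then Lim (at_left t) (bspline_rec T n i) else bspline_rec T n i t)"

definition preimage_knots :: "real \<Rightarrow> real list" where
  "preimage_knots a = [0, 0, 0, a, 1, 1, 1]"

definition preimage :: "real \<Rightarrow> (nat \<Rightarrow> complex) \<Rightarrow> real \<Rightarrow> complex" where
  "preimage a z t = (\<Sum>i = 0..3. z i * of_real (bspline (preimage_knots a) 2 i t))"

text \<open>Only the values of \<open>r\<close> on \<open>{0..1}\<close> matter.  The class of curves consists of all \<open>r\<close> satisfying
  this predicate for some coefficients \<open>z 0, \<dots>, z 3\<close> and some \<open>r0\<close>.\<close>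

definition ph_curve :: "real \<Rightarrow> (nat \<Rightarrow> complex) \<Rightarrow> complex \<Rightarrow> (real \<Rightarrow> complex) \<Rightarrow> bool" where
  "ph_curve a z r0 r \<longleftrightarrow>
     r 0 = r0 \<and>
     (\<forall>t\<in>{0..1}. (r has_vector_derivative (preimage a z t)\<^sup>2) (at t within {0..1}))"

text \<open>Differentiating within \<open>{0..1}\<close> gives the one-sided derivatives at the endpoints.\<close>

definition ph_curvature :: "real \<Rightarrow> (nat \<Rightarrow> complex) \<Rightarrow> real \<Rightarrow> real" where
  "ph_curvature a z t =
     2 * Im (cnj (preimage a z t) * vector_derivative (preimage a z) (at t within {0..1}))
       / cmod (preimage a z t) ^ 4"

end

theory Submission
  imports Defs
begin

text \<open>Inserting the knot \<open>a\<close> once more splits the preimage into two quadratic Bezier curves, with control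
  points \<open>z 0, z 1, m\<close> and \<open>m, z 2, z 3\<close>, where \<open>m = (1 - a) z 1 + a z 2\<close>.  The end values, the end
  curvatures and the integral of the square can be read off from these.  The curve \<open>r\<close> determines the
  preimage only up to sign at each parameter, but the curvature depends on the square of the preimage
  alone.  Fixing the sign by \<open>z 0\<close> leaves the two signs of \<open>z 3\<close>; since
  \<open>\<bar>\<omega>\<^sub>k\<bar> < \<pi>\<close>, the real parts \<open>u 0\<close> and \<open>u 3\<close> do not vanish, so that the curvature conditions can be
  solved for \<open>v 1\<close> and \<open>v 2\<close>.\<close>

section \<open>Quadratic B-splines on the two knot intervals\<close>

lemma bspline_rec_left:
  assumes "0 < a" "a < 1" "0 \<le> t" "t < a"
  shows "bspline_rec (preimage_knots a) 2 0 t = (1 - t / a)\<^sup>2"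
    and "bspline_rec (preimage_knots a) 2 1 t
           = 2 * (t / a) * (1 - t / a) + (1 - a) * (t / a)\<^sup>2"
    and "bspline_rec (preimage_knots a) 2 2 t = a * (t / a)\<^sup>2"
    and "bspline_rec (preimage_knots a) 2 3 t = 0"
  using assms
  by (simp_all add: preimage_knots_def numeral_2_eq_2 numeral_3_eq_3,
      simp_all add: field_simps power2_eq_square)

text \<open>As on the left interval, the right sides are combinations of Bernstein polynomials in
  the local parameter. The factors \<open>1 - a\<close> and \<open>a\<close> are the shares of the
  control points 1 and 2 in the value at the knot \<open>a\<close>.\<close>

lemma bspline_rec_right:
  assumes "0 < a" "a < 1" "a \<le> t" "t < 1"
  shows "bspline_rec (preimage_knots a) 2 0 t = 0"
    and "bspline_rec (preimage_knots a) 2 1 t = (1 - a) * (1 - (t - a) / (1 - a))\<^sup>2"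
    and "bspline_rec (preimage_knots a) 2 2 t
           = a * (1 - (t - a) / (1 - a))\<^sup>2
             + 2 * ((t - a) / (1 - a)) * (1 - (t - a) / (1 - a))"
    and "bspline_rec (preimage_knots a) 2 3 t = ((t - a) / (1 - a))\<^sup>2"
proof -
  \<comment> \<open>Substituting \<open>t = a + h * s\<close> and then \<open>a = 1 - h\<close>
    leaves identities in \<open>h\<close> and \<open>s\<close> alone, with \<open>h > 0\<close> to
    clear the denominators.\<close>
  define h s where "h = 1 - a" and "s = (t - a) / h"
  have h: "h > 0" "t = a + h * s" "a = 1 - h" using assms by (auto simp: h_def s_def)
  have "bspline_rec (preimage_knots a) 2 0 t = 0
    \<and> bspline_rec (preimage_knots a) 2 1 t = h * (1 - s)\<^sup>2
    \<and> bspline_rec (preimage_knots a) 2 2 t = a * (1 - s)\<^sup>2 + 2 * s * (1 - s)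
    \<and> bspline_rec (preimage_knots a) 2 3 t = s\<^sup>2"
    by (use assms in \<open>simp add: preimage_knots_def numeral_2_eq_2 numeral_3_eq_3\<close>,
        use h(1) in \<open>unfold h(2), unfold h(3), simp add: field_simps power2_eq_square\<close>)
  then show "bspline_rec (preimage_knots a) 2 0 t = 0"
    and "bspline_rec (preimage_knots a) 2 1 t = (1 - a) * (1 - (t - a) / (1 - a))\<^sup>2"
    and "bspline_rec (preimage_knots a) 2 2 t
           = a * (1 - (t - a) / (1 - a))\<^sup>2
             + 2 * ((t - a) / (1 - a)) * (1 - (t - a) / (1 - a))"
    and "bspline_rec (preimage_knots a) 2 3 t = ((t - a) / (1 - a))\<^sup>2"
    by (simp_all add: h_def s_def)
qed

section \<open>The preimage as two quadratic Bezier curves\<close>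

definition bez :: "complex \<Rightarrow> complex \<Rightarrow> complex \<Rightarrow> real \<Rightarrow> complex" where
  "bez b0 b1 b2 s = b0 * of_real ((1 - s)\<^sup>2) + b1 * of_real (2 * s * (1 - s)) + b2 * of_real (s\<^sup>2)"

lemma bez_0 [simp]: "bez b0 b1 b2 0 = b0"
  and bez_1 [simp]: "bez b0 b1 b2 1 = b2"
  by (simp_all add: bez_def)

lemma sum_atLeast0_atMost3:
  fixes f :: "nat \<Rightarrow> 'a :: comm_monoid_add"
  shows "(\<Sum>i = 0..3. f i) = f 0 + f 1 + f 2 + f 3"
  by (simp add: numeral_2_eq_2 numeral_3_eq_3)

lemma bspline_preimage_knots:
  assumes "t < 1"
  shows "bspline (preimage_knots a) n i t = bspline_rec (preimage_knots a) n i t"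
  using assms by (simp add: bspline_def preimage_knots_def)

text \<open>The value at 1 is a left limit. On \<open>[a, 1)\<close> the recursion agrees with a
  function \<open>p\<close> that is left-continuous at 1, so the limit is
  \<open>p 1\<close>.\<close>

lemma bspline_at_1:
  assumes "0 < a" "a < 1"
  shows "bspline (preimage_knots a) 2 0 1 = 0"
    and "bspline (preimage_knots a) 2 1 1 = 0"
    and "bspline (preimage_knots a) 2 2 1 = 0"
    and "bspline (preimage_knots a) 2 3 1 = 1"
proof -
  have lim: "bspline (preimage_knots a) 2 i 1 = p 1"
    if cont: "continuous (at_left 1) p"
      and eq: "\<And>t. a \<le> t \<Longrightarrow> t < 1 \<Longrightarrow> bspline_rec (preimage_knots a) 2 i t = p t" for i p
  proof -
    have "eventually (\<lambda>t. t \<in> {a<..<1}) (at_left (1::real))"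
      using assms eventually_at_left_real by blast
    then have "eventually (\<lambda>t. p t = bspline_rec (preimage_knots a) 2 i t) (at_left 1)"
      by eventually_elim (simp add: eq)
    moreover have "(p \<longlongrightarrow> p 1) (at_left 1)"
      using cont by (simp add: continuous_within)
    ultimately have "(bspline_rec (preimage_knots a) 2 i \<longlongrightarrow> p 1) (at_left 1)"
      by (rule Lim_transform_eventually[rotated])
    then show ?thesis
      by (simp add: bspline_def preimage_knots_def tendsto_Lim)
  qed
  have h: "1 - a \<noteq> 0" using assms by simp
  show "bspline (preimage_knots a) 2 0 1 = 0"
    by (rule trans[OF lim[OF _ bspline_rec_right(1)[OF assms]]]) auto
  show "bspline (preimage_knots a) 2 1 1 = 0"
    by (rule trans[OF lim[OF _ bspline_rec_right(2)[OF assms]]]) (use h in \<open>auto intro!: continuous_intros\<close>)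
  show "bspline (preimage_knots a) 2 2 1 = 0"
    by (rule trans[OF lim[OF _ bspline_rec_right(3)[OF assms]]]) (use h in \<open>auto intro!: continuous_intros\<close>)
  show "bspline (preimage_knots a) 2 3 1 = 1"
    by (rule trans[OF lim[OF _ bspline_rec_right(4)[OF assms]]]) (use h in \<open>auto intro!: continuous_intros\<close>)
qed

text \<open>The inserted control point \<open>m\<close>: the value of the preimage at
  \<open>a\<close> and the joint of the two Bezier curves.\<close>

definition knot_value :: "real \<Rightarrow> (nat \<Rightarrow> complex) \<Rightarrow> complex" where
  "knot_value a z = of_real (1 - a) * z 1 + of_real a * z 2"

lemma preimage_right:
  assumes "0 < a" "a < 1" "a \<le> t" "t \<le> 1"
  shows "preimage a z t = bez (knot_value a z) (z 2) (z 3) ((t - a) / (1 - a))"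
proof (cases "t = 1")
  case True
  then show ?thesis
    using assms by (simp add: preimage_def sum_atLeast0_atMost3 bspline_at_1[OF assms(1,2), simplified One_nat_def])
next
  case False
  then have "t < 1" using assms by simp
  then show ?thesis
    unfolding preimage_def sum_atLeast0_atMost3 bspline_preimage_knots[OF \<open>t < 1\<close>]
      bspline_rec_right[OF assms(1-3) \<open>t < 1\<close>] bez_def knot_value_def
    by (simp add: algebra_simps)
qed

lemma preimage_left:
  assumes "0 < a" "a < 1" "0 \<le> t" "t \<le> a"
  shows "preimage a z t = bez (z 0) (z 1) (knot_value a z) (t / a)"
\<comment> \<open>The half-open knot intervals assign the parameter \<open>a\<close> to the right
  piece, which starts where the left one ends.\<close>
proof (cases "t = a")
  case True
  then show ?thesis
    using assms preimage_right[of a a z] by simp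
next
  case False
  then have "t < a" "t < 1" using assms by auto
  then show ?thesis
    unfolding preimage_def sum_atLeast0_atMost3 bspline_preimage_knots[OF \<open>t < 1\<close>]
      bspline_rec_left[OF assms(1-3) \<open>t < a\<close>] bez_def knot_value_def
    by (simp add: algebra_simps)
qed

lemma preimage_0: "0 < a \<Longrightarrow> a < 1 \<Longrightarrow> preimage a z 0 = z 0"
  using preimage_left[of a 0 z] by simp

lemma preimage_1: "0 < a \<Longrightarrow> a < 1 \<Longrightarrow> preimage a z 1 = z 3"
  using preimage_right[of a 1 z] by simp

section \<open>Derivatives, integrals of squares and the displacement of the curve\<close>

lemma bez_has_vector_derivative:
  assumes "h \<noteq> 0"
  shows "((\<lambda>t. bez b0 b1 b2 ((t - c) / h)) has_vector_derivative
     of_real (2 / h) * bez (b1 - b0) ((b2 - b0) / 2) (b2 - b1) ((t - c) / h)) (at t within S)"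
proof -
  have "((\<lambda>t. (1 - (t - c) / h)\<^sup>2) has_real_derivative - 2 / h * (1 - (t - c) / h)) (at t within S)"
    "((\<lambda>t. 2 * ((t - c) / h) * (1 - (t - c) / h)) has_real_derivative
       2 / h * (1 - 2 * ((t - c) / h))) (at t within S)"
    "((\<lambda>t. ((t - c) / h)\<^sup>2) has_real_derivative 2 / h * ((t - c) / h)) (at t within S)"
    using assms by (auto intro!: derivative_eq_intros simp: field_simps eval_nat_numeral)
  note this[THEN has_vector_derivative_of_real, THEN has_vector_derivative_mult_right]
  note has_vector_derivative_add[OF has_vector_derivative_add[OF this(1)[of b0] this(2)[of b1]] this(3)[of b2]]
  \<comment> \<open>Up to \<open>2 / h\<close> the derivative runs linearly from
    \<open>b1 - b0\<close> to \<open>b2 - b1\<close>; degree elevation inserts their mean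
    \<open>(b2 - b0) / 2\<close> as middle control point.\<close>
  moreover have "b0 * of_real (- 2 / h * (1 - s)) + b1 * of_real (2 / h * (1 - 2 * s))
      + b2 * of_real (2 / h * s) =
      of_real (2 / h) * bez (b1 - b0) ((b2 - b0) / 2) (b2 - b1) s" for s
    by (simp add: bez_def algebra_simps power2_eq_square add_divide_distrib diff_divide_distrib)
  ultimately show ?thesis
    by (simp only: bez_def)
qed

lemma power_affine_has_vector_derivative:
  assumes "h \<noteq> 0"
  shows "((\<lambda>t. of_real (h * ((t - c) / h) ^ Suc n)) has_vector_derivative
     of_nat (Suc n) * (of_real ((t - c) / h) ^ n :: complex)) (at t within S)"
proof -
  have "((\<lambda>t. h * ((t - c) / h) ^ Suc n) has_real_derivative
     of_nat (Suc n) * ((t - c) / h) ^ n) (at t within S)"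
    by (rule derivative_eq_intros refl | use assms in simp)+
  from has_vector_derivative_of_real[OF this] show ?thesis
    by (simp only: of_real_mult of_real_power of_real_of_nat_eq)
qed

text \<open>The five summands are the control points of the square as a quartic Bezier curve, whose
  integral is the interval length times their mean.\<close>

lemma has_integral_bez_square:
  assumes "0 < h"
  shows "((\<lambda>t. (bez b0 b1 b2 ((t - c) / h))\<^sup>2) has_integral
     of_real (h / 5) * (b0\<^sup>2 + b0 * b1 + (2 * b1\<^sup>2 + b0 * b2) / 3 + b1 * b2 + b2\<^sup>2)) {c..c + h}"
proof -
  \<comment> \<open>Squaring \<open>b0 + 2 * (b1 - b0) * s + (b0 - 2 * b1 + b2) * s^2\<close> and
    dividing the coefficient of \<open>s^i\<close> by \<open>i + 1\<close> gives \<open>q i\<close>,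
    so \<open>F\<close> is a primitive that vanishes at \<open>c\<close>.\<close>
  define q where "q = (\<lambda>i::nat. [b0\<^sup>2, 2 * b0 * (b1 - b0),
    (2 * b0 * (b0 - 2 * b1 + b2) + 4 * (b1 - b0)\<^sup>2) / 3,
    (b1 - b0) * (b0 - 2 * b1 + b2), (b0 - 2 * b1 + b2)\<^sup>2 / 5] ! i)"
  define F where "F t = (\<Sum>i<5. q i * of_real (h * ((t - c) / h) ^ Suc i))" for t
  have "(F has_vector_derivative (bez b0 b1 b2 ((t - c) / h))\<^sup>2) (at t within S)" for t S
  proof -
    define s where "s = complex_of_real ((t - c) / h)"
    have "(F has_vector_derivative (\<Sum>i<5. q i * (of_nat (Suc i) * s ^ i))) (at t within S)"
      unfolding F_def s_def using assms
      by (intro has_vector_derivative_sum has_vector_derivative_mult_right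
          power_affine_has_vector_derivative) auto
    also have "(\<Sum>i<5. q i * (of_nat (Suc i) * s ^ i)) =
      (b0 * (1 - s)\<^sup>2 + b1 * (2 * s * (1 - s)) + b2 * s\<^sup>2)\<^sup>2"
      by (simp add: q_def eval_nat_numeral) (simp add: algebra_simps)
    also have "\<dots> = (bez b0 b1 b2 ((t - c) / h))\<^sup>2"
      by (simp add: bez_def s_def)
    finally show ?thesis .
  qed
  then have "((\<lambda>t. (bez b0 b1 b2 ((t - c) / h))\<^sup>2) has_integral F (c + h) - F c) {c..c + h}"
    using assms by (intro fundamental_theorem_of_calculus) auto
  moreover have "F (c + h) - F c = of_real h * (\<Sum>i<5. q i)"
    using assms by (simp add: F_def sum_distrib_left mult.commute)
  moreover have "(\<Sum>i<5. q i) =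
      (b0\<^sup>2 + b0 * b1 + (2 * b1\<^sup>2 + b0 * b2) / 3 + b1 * b2 + b2\<^sup>2) / 5"
    by (simp add: q_def eval_nat_numeral) (simp add: field_simps)
  ultimately show ?thesis by simp
qed

text \<open>The squares of the two Bezier pieces are integrated and \<open>m\<close> is expanded.
  The terms in \<open>z 3\<close> and \<open>z 0\<close> alone stand apart because the tangent
  conditions turn them into multiples of \<open>d1\<close> and \<open>d0\<close>.\<close>

lemma ph_curve_increment:
  assumes "0 < a" "a < 1" "ph_curve a z r0 r"
  shows "r 1 - r 0 =
      of_real ((1 - a) / 5) * (z 3)\<^sup>2 + of_real (a / 5) * (z 0)\<^sup>2
    + (of_real (1 / 5 * (1 - a / 3)) * (z 1)\<^sup>2
     + of_real (1 / 15 * (2 + a)) * (z 2)\<^sup>2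
     + of_real (1 / 5) * z 1 * z 2
     + of_real (1 / 15 * (1 - a)\<^sup>2) * z 1 * z 3
     + of_real (1 / 15 * a * (4 - a)) * z 0 * z 1
     + of_real (1 / 15 * (3 - 2 * a - a\<^sup>2)) * z 2 * z 3
     + of_real (1 / 15 * a\<^sup>2) * z 0 * z 2)"
proof -
  define m where "m = knot_value a z"
  define I where "I h b0 b1 b2 = of_real (h / 5) *
      (b0\<^sup>2 + b0 * b1 + (2 * b1\<^sup>2 + b0 * b2) / 3 + b1 * b2 + b2\<^sup>2)" for h and b0 b1 b2 :: complex
  have "((\<lambda>t. (bez (z 0) (z 1) m ((t - 0) / a))\<^sup>2) has_integral I a (z 0) (z 1) m) {0..0 + a}"
    unfolding I_def by (rule has_integral_bez_square) (use assms in simp)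
  then have "((\<lambda>t. (preimage a z t)\<^sup>2) has_integral I a (z 0) (z 1) m) {0..a}"
    using assms preimage_left[of a _ z] by (subst has_integral_cong) (auto simp: m_def)
  moreover have "((\<lambda>t. (bez m (z 2) (z 3) ((t - a) / (1 - a)))\<^sup>2) has_integral
      I (1 - a) m (z 2) (z 3)) {a..a + (1 - a)}"
    unfolding I_def by (rule has_integral_bez_square) (use assms in simp)
  then have "((\<lambda>t. (preimage a z t)\<^sup>2) has_integral I (1 - a) m (z 2) (z 3)) {a..1}"
    using assms preimage_right[of a _ z] by (subst has_integral_cong) (auto simp: m_def)
  ultimately have "((\<lambda>t. (preimage a z t)\<^sup>2) has_integral
      I a (z 0) (z 1) m + I (1 - a) m (z 2) (z 3)) {0..1}"
    using assms by (intro has_integral_combine[where c = a]) auto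
  moreover have "((\<lambda>t. (preimage a z t)\<^sup>2) has_integral r 1 - r 0) {0..1}"
    using assms by (intro fundamental_theorem_of_calculus) (auto simp: ph_curve_def)
  ultimately have *: "r 1 - r 0 = I a (z 0) (z 1) m + I (1 - a) m (z 2) (z 3)"
    using has_integral_unique by blast
  show ?thesis
    unfolding * by (simp add: I_def m_def knot_value_def field_simps power2_eq_square)
qed

section \<open>End derivatives and end curvatures\<close>

lemma preimage_has_vector_derivative_0:
  assumes "0 < a" "a < 1"
  shows "(preimage a z has_vector_derivative of_real (2 / a) * (z 1 - z 0)) (at 0 within {0..1})"
\<comment> \<open>Within distance \<open>a\<close> of 0 the preimage is its left Bezier
  piece.\<close>
proof (rule has_vector_derivative_transform_within[where d = a])
  show "((\<lambda>t. bez (z 0) (z 1) (knot_value a z) ((t - 0) / a)) has_vector_derivative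
      of_real (2 / a) * (z 1 - z 0)) (at 0 within {0..1})"
    using bez_has_vector_derivative[of a "z 0" "z 1" "knot_value a z" 0 0 "{0..1}"] assms by simp
qed (use assms preimage_left[of a _ z] in auto)

lemma preimage_has_vector_derivative_1:
  assumes "0 < a" "a < 1"
  shows "(preimage a z has_vector_derivative of_real (2 / (1 - a)) * (z 3 - z 2)) (at 1 within {0..1})"
proof (rule has_vector_derivative_transform_within[where d = "1 - a"])
  show "((\<lambda>t. bez (knot_value a z) (z 2) (z 3) ((t - a) / (1 - a))) has_vector_derivative
      of_real (2 / (1 - a)) * (z 3 - z 2)) (at 1 within {0..1})"
    using bez_has_vector_derivative[of "1 - a" "knot_value a z" "z 2" "z 3" a 1 "{0..1}"] assms by simp
qed (use assms preimage_right[of a _ z] in \<open>auto simp: dist_real_def\<close>)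

text \<open>\<open>cnj (z 0) * z 0\<close> is real and drops out of the imaginary part.\<close>

lemma ph_curvature_0:
  assumes "0 < a" "a < 1"
  shows "ph_curvature a z 0 = 4 / a * Im (cnj (z 0) * z 1) / cmod (z 0) ^ 4"
proof -
  have "vector_derivative (preimage a z) (at 0 within {0..1}) = of_real (2 / a) * (z 1 - z 0)"
    using vector_derivative_within_closed_interval[OF _ _ preimage_has_vector_derivative_0[OF assms]]
    by simp
  moreover have "2 * Im (cnj x * (of_real (2 / a) * (y - x))) = 4 / a * Im (cnj x * y)" for x y
    using assms by (simp add: field_simps)
  ultimately show ?thesis
    using assms by (simp only: ph_curvature_def preimage_0)
qed

text \<open>Here the neighbouring control point is subtracted; absorbing the sign into
  \<open>a - 1\<close> gives both ends the form treated by \<open>curvature_eq_iff\<close>.\<close>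

lemma ph_curvature_1:
  assumes "0 < a" "a < 1"
  shows "ph_curvature a z 1 = 4 / (a - 1) * Im (cnj (z 3) * z 2) / cmod (z 3) ^ 4"
proof -
  have "vector_derivative (preimage a z) (at 1 within {0..1}) = of_real (2 / (1 - a)) * (z 3 - z 2)"
    using vector_derivative_within_closed_interval[OF _ _ preimage_has_vector_derivative_1[OF assms]]
    by simp
  moreover have "2 * Im (cnj x * (of_real (2 / h) * (x - y))) = 4 / - h * Im (cnj x * y)"
    if "h \<noteq> 0" for x y h
    using that by (simp add: field_simps)
  from this[of "1 - a"] have "2 * Im (cnj x * (of_real (2 / (1 - a)) * (x - y)))
      = 4 / (a - 1) * Im (cnj x * y)" for x y
    using assms by (simp only: minus_diff_eq)
  ultimately show ?thesis
    using assms by (simp only: ph_curvature_def preimage_1)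
qed

section \<open>Independence of the curvature from the choice of preimage\<close>

lemma ph_curve_has_vector_derivative_iff:
  assumes "ph_curve a z r0 r" "t \<in> {0..1}"
  shows "(r has_vector_derivative d) (at t within {0..1}) \<longleftrightarrow> d = (preimage a z t)\<^sup>2"
  using assms vector_derivative_unique_within_closed_interval[of 0 1 t r d "(preimage a z t)\<^sup>2"]
  by (auto simp: ph_curve_def)

text \<open>Both squares are the derivative of \<open>r\<close>, so differentiating them avoids
  choosing a sign along the interval: \<open>f * f' = g * g'\<close>. Where \<open>f = g\<close> or
  \<open>f = - g\<close> is nonzero, the derivatives are related by the same sign, which cancels in
  the curvature.\<close>

lemma ph_curvature_unique:
  assumes "ph_curve a z r0 r" "ph_curve a w s0 r" "t \<in> {0..1}"
    and z': "(preimage a z has_vector_derivative z') (at t within {0..1})"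
    and w': "(preimage a w has_vector_derivative w') (at t within {0..1})"
  shows "ph_curvature a z t = ph_curvature a w t"
proof -
  let ?f = "preimage a z" and ?g = "preimage a w"
  have sq: "(?f x)\<^sup>2 = (?g x)\<^sup>2" if "x \<in> {0..1}" for x
    using that assms(1,2) ph_curve_has_vector_derivative_iff[of a z r0 r x "(?g x)\<^sup>2"]
    by (auto simp: ph_curve_def)
  have "((\<lambda>x. ?f x * ?f x) has_vector_derivative 2 * ?f t * z') (at t within {0..1})"
    using has_vector_derivative_mult[OF z' z'] by (simp add: algebra_simps)
  moreover have "((\<lambda>x. ?g x * ?g x) has_vector_derivative 2 * ?g t * w') (at t within {0..1})"
    using has_vector_derivative_mult[OF w' w'] by (simp add: algebra_simps)
  then have "((\<lambda>x. ?f x * ?f x) has_vector_derivative 2 * ?g t * w') (at t within {0..1})"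
    by (rule has_vector_derivative_transform_within[where d = 1])
       (use assms sq in \<open>auto simp: power2_eq_square\<close>)
  ultimately have "2 * ?f t * z' = 2 * ?g t * w'"
    using vector_derivative_unique_within_closed_interval[of 0 1 t] assms(3) by fastforce
  then have eq: "?f t * z' = ?g t * w'"
    by simp
  have vd: "vector_derivative ?f (at t within {0..1}) = z'" "vector_derivative ?g (at t within {0..1}) = w'"
    using vector_derivative_within_closed_interval[OF _ assms(3)] z' w' by auto
  consider "?f t = 0" "?g t = 0" | "?g t \<noteq> 0" "?f t = ?g t" | "?g t \<noteq> 0" "?f t = - ?g t"
    using sq[OF assms(3)] by (cases "?g t = 0") (auto simp: power2_eq_iff)
  then show ?thesis
  proof cases
    \<comment> \<open>Both curvatures are \<open>0 / 0 = 0\<close>.\<close>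
    case 1
    then show ?thesis by (simp add: ph_curvature_def)
  next
    case 2
    then have "z' = w'" using eq by simp
    then show ?thesis using 2 by (simp add: ph_curvature_def vd)
  next
    case 3
    then have "?g t * (z' + w') = ?g t * w' - ?f t * z'" by (simp add: algebra_simps)
    also have "\<dots> = 0" using eq by simp
    finally have "z' = - w'" using 3 by (simp add: eq_neg_iff_add_eq_0)
    then show ?thesis using 3 by (simp add: ph_curvature_def vd)
  qed
qed

section \<open>Roots of the end tangents and the curvature equations\<close>

lemma half_Arg_root:
  assumes "d \<noteq> 0" "Arg d \<noteq> pi"
  defines "q \<equiv> of_real (sqrt (cmod d)) * exp (\<i> * of_real (Arg d / 2))"
  shows "q\<^sup>2 = d" "0 < Re q"
proof -
  have "q\<^sup>2 = of_real (cmod d) * exp (\<i> * of_real (Arg d))"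
    by (simp add: q_def power_mult_distrib exp_double[symmetric] flip: of_real_power)
  then show "q\<^sup>2 = d"
    using Arg_eq[OF assms(1)] by simp
  \<comment> \<open>Excluding the argument \<open>pi\<close> keeps its half strictly inside the
    interval where the cosine is positive.\<close>
  have "- (pi / 2) < Arg d / 2" "Arg d / 2 < pi / 2"
    using mpi_less_Arg[of d] Arg_le_pi[of d] assms(2) by auto
  then show "0 < Re q"
    using assms(1) by (simp add: q_def Re_exp cos_gt_zero_pi)
qed

text \<open>\<open>Im (cnj x * y)\<close> equals \<open>Re x * Im y - Im x * Re y\<close>, which is
  linear in \<open>Im y\<close> with coefficient \<open>Re x\<close>. The two ends use
  \<open>c = a\<close> and \<open>c = a - 1\<close>.\<close>

lemma curvature_eq_iff:
  assumes "Re x \<noteq> 0" "c \<noteq> 0"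
  shows "4 / c * Im (cnj x * y) / cmod x ^ 4 = k \<longleftrightarrow>
    Im y = 1 / Re x * (Re y * Im x + c / 4 * k * ((Re x)\<^sup>2 + (Im x)\<^sup>2)\<^sup>2)"
proof -
  have "cmod x ^ 4 = ((Re x)\<^sup>2 + (Im x)\<^sup>2)\<^sup>2"
    unfolding cmod_power2[symmetric] by simp
  moreover have "(Re x)\<^sup>2 + (Im x)\<^sup>2 \<noteq> 0"
    using assms(1) by (simp add: sum_power2_eq_zero_iff)
  ultimately show ?thesis
    using assms by (auto simp: field_simps)
qed

lemma preimage_scale: "preimage a (\<lambda>k. c * z k) t = c * preimage a z t"
  by (simp add: preimage_def sum_distrib_left mult.assoc)

theorem mainTheorem15:
  fixes a :: real and p0 p1 d0 d1 :: complex and \<kappa>0 \<kappa>1 \<omega>0 \<omega>1 :: real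
    and r :: "real \<Rightarrow> complex" and w :: "nat \<Rightarrow> complex" and r0 :: complex
  assumes "0 < a" and "a < 1"
    and "d0 \<noteq> 0" and "d1 \<noteq> 0"
    and "\<omega>0 = Arg d0" and "\<omega>1 = Arg d1"
    and "\<omega>0 \<noteq> pi" and "\<omega>1 \<noteq> pi"
    and "ph_curve a w r0 r"
  shows
    "(r 0 = p0 \<and> r 1 = p1 \<and>
      (r has_vector_derivative d0) (at 0 within {0..1}) \<and>
      (r has_vector_derivative d1) (at 1 within {0..1}) \<and>
      ph_curvature a w 0 = \<kappa>0 \<and> ph_curvature a w 1 = \<kappa>1)
     \<longleftrightarrow>
     (\<exists>(z :: nat \<Rightarrow> complex) (u :: nat \<Rightarrow> real) (v :: nat \<Rightarrow> real).
        (\<forall>k\<le>3. z k = of_real (u k) + \<i> * of_real (v k)) \<and>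
        ph_curve a z p0 r \<and>
        z 0 = of_real (sqrt (cmod d0)) * exp (\<i> * of_real (\<omega>0 / 2)) \<and>
        (z 3 = of_real (sqrt (cmod d1)) * exp (\<i> * of_real (\<omega>1 / 2)) \<or>
         z 3 = - (of_real (sqrt (cmod d1)) * exp (\<i> * of_real (\<omega>1 / 2)))) \<and>
        v 1 = 1 / u 0 * (u 1 * v 0 + a / 4 * \<kappa>0 * ((u 0)\<^sup>2 + (v 0)\<^sup>2)\<^sup>2) \<and>
        v 2 = 1 / u 3 * (u 2 * v 3 - (1 - a) / 4 * \<kappa>1 * ((u 3)\<^sup>2 + (v 3)\<^sup>2)\<^sup>2) \<and>
        (let z1 = of_real (u 1)
               + \<i> / of_real (u 0) * of_real (u 1 * v 0 + a / 4 * \<kappa>0 * ((u 0)\<^sup>2 + (v 0)\<^sup>2)\<^sup>2);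
             z2 = of_real (u 2)
               + \<i> / of_real (u 3) * of_real (u 2 * v 3 - (1 - a) / 4 * \<kappa>1 * ((u 3)\<^sup>2 + (v 3)\<^sup>2)\<^sup>2);
             lhs = p1 - p0 - of_real ((1 - a) / 5) * d1 - of_real (a / 5) * d0;
             rhs = of_real (1 / 5 * (1 - a / 3)) * z1\<^sup>2
               + of_real (1 / 15 * (2 + a)) * z2\<^sup>2
               + of_real (1 / 5) * z1 * z2
               + of_real (1 / 15 * (1 - a)\<^sup>2) * z1 * z 3
               + of_real (1 / 15 * a * (4 - a)) * z 0 * z1
               + of_real (1 / 15 * (3 - 2 * a - a\<^sup>2)) * z2 * z 3
               + of_real (1 / 15 * a\<^sup>2) * z 0 * z2
         in Re lhs = Re rhs \<and> Im lhs = Im rhs))"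
proof -
  note a = assms(1,2)
  define q0 q1 where "q0 = of_real (sqrt (cmod d0)) * exp (\<i> * of_real (\<omega>0 / 2))"
    and "q1 = of_real (sqrt (cmod d1)) * exp (\<i> * of_real (\<omega>1 / 2))"
  have q0: "q0\<^sup>2 = d0" "0 < Re q0"
    using half_Arg_root[of d0] assms by (auto simp: q0_def)
  have q1: "q1\<^sup>2 = d1" "0 < Re q1"
    using half_Arg_root[of d1] assms by (auto simp: q1_def)
  \<comment> \<open>With \<open>z 0\<close> and \<open>z 3\<close> fixed as roots of the tangents,
    the three remaining end conditions match the three remaining equations. Both directions of the
    equivalence rest on this.\<close>
  have data: "(r 1 = p1 \<and> ph_curvature a z 0 = \<kappa>0 \<and> ph_curvature a z 1 = \<kappa>1) \<longleftrightarrow>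
        v 1 = 1 / u 0 * (u 1 * v 0 + a / 4 * \<kappa>0 * ((u 0)\<^sup>2 + (v 0)\<^sup>2)\<^sup>2) \<and>
        v 2 = 1 / u 3 * (u 2 * v 3 - (1 - a) / 4 * \<kappa>1 * ((u 3)\<^sup>2 + (v 3)\<^sup>2)\<^sup>2) \<and>
        (let z1 = of_real (u 1)
               + \<i> / of_real (u 0) * of_real (u 1 * v 0 + a / 4 * \<kappa>0 * ((u 0)\<^sup>2 + (v 0)\<^sup>2)\<^sup>2);
             z2 = of_real (u 2)
               + \<i> / of_real (u 3) * of_real (u 2 * v 3 - (1 - a) / 4 * \<kappa>1 * ((u 3)\<^sup>2 + (v 3)\<^sup>2)\<^sup>2);
             lhs = p1 - p0 - of_real ((1 - a) / 5) * d1 - of_real (a / 5) * d0;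
             rhs = of_real (1 / 5 * (1 - a / 3)) * z1\<^sup>2
               + of_real (1 / 15 * (2 + a)) * z2\<^sup>2
               + of_real (1 / 5) * z1 * z2
               + of_real (1 / 15 * (1 - a)\<^sup>2) * z1 * z 3
               + of_real (1 / 15 * a * (4 - a)) * z 0 * z1
               + of_real (1 / 15 * (3 - 2 * a - a\<^sup>2)) * z2 * z 3
               + of_real (1 / 15 * a\<^sup>2) * z 0 * z2
         in Re lhs = Re rhs \<and> Im lhs = Im rhs)"
    if z: "\<forall>k\<le>3. z k = of_real (u k) + \<i> * of_real (v k)"
      and ph: "ph_curve a z p0 r" and z0: "z 0 = q0" and z3: "z 3 = q1 \<or> z 3 = - q1"
    for z :: "nat \<Rightarrow> complex" and u v :: "nat \<Rightarrow> real"
  proof -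
    have uv: "u k = Re (z k)" "v k = Im (z k)" if "k \<le> 3" for k
      using z that by auto
    have nz: "Re (z 0) \<noteq> 0" "Re (z 3) \<noteq> 0"
      using z0 z3 q0 q1 by auto
    have d: "d0 = (z 0)\<^sup>2" "d1 = (z 3)\<^sup>2"
      using z0 z3 q0 q1 by auto
    have "r 0 = p0" using ph by (simp add: ph_curve_def)
    have \<kappa>: "(ph_curvature a z 0 = \<kappa>0) =
          (v 1 = 1 / u 0 * (u 1 * v 0 + a / 4 * \<kappa>0 * ((u 0)\<^sup>2 + (v 0)\<^sup>2)\<^sup>2))"
        "(ph_curvature a z 1 = \<kappa>1) =
          (v 2 = 1 / u 3 * (u 2 * v 3 - (1 - a) / 4 * \<kappa>1 * ((u 3)\<^sup>2 + (v 3)\<^sup>2)\<^sup>2))"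
    proof -
      show "(ph_curvature a z 0 = \<kappa>0) =
          (v 1 = 1 / u 0 * (u 1 * v 0 + a / 4 * \<kappa>0 * ((u 0)\<^sup>2 + (v 0)\<^sup>2)\<^sup>2))"
        using curvature_eq_iff[OF nz(1), of a "z 1" \<kappa>0] a by (simp add: uv ph_curvature_0)
      have sign: "x - (1 - a) / 4 * y * c = x + (a - 1) / 4 * y * c" for x y c
        by (simp add: field_simps)
      show "(ph_curvature a z 1 = \<kappa>1) =
          (v 2 = 1 / u 3 * (u 2 * v 3 - (1 - a) / 4 * \<kappa>1 * ((u 3)\<^sup>2 + (v 3)\<^sup>2)\<^sup>2))"
        using curvature_eq_iff[OF nz(2), of "a - 1" "z 2" \<kappa>1] a
        by (simp only: sign uv ph_curvature_1[OF a])
    qed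
    have end_value: "r 1 = p1 \<longleftrightarrow> p1 - p0 - of_real ((1 - a) / 5) * d1 - of_real (a / 5) * d0
            = of_real (1 / 5 * (1 - a / 3)) * (z 1)\<^sup>2
               + of_real (1 / 15 * (2 + a)) * (z 2)\<^sup>2
               + of_real (1 / 5) * z 1 * z 2
               + of_real (1 / 15 * (1 - a)\<^sup>2) * z 1 * z 3
               + of_real (1 / 15 * a * (4 - a)) * z 0 * z 1
               + of_real (1 / 15 * (3 - 2 * a - a\<^sup>2)) * z 2 * z 3
               + of_real (1 / 15 * a\<^sup>2) * z 0 * z 2" (is "_ \<longleftrightarrow> _ = ?rhs")
    proof -
      have rearrange: "x1 = y \<longleftrightarrow> y - x0 - b - c = e" if "x1 - x0 = b + c + e"
        for x0 x1 y b c e :: complex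
      proof -
        have "x1 = x0 + b + c + e" using that by (simp add: algebra_simps)
        then show ?thesis by (auto simp: algebra_simps)
      qed
      show ?thesis
        by (rule rearrange) (use ph_curve_increment[OF a ph] in \<open>simp only: d \<open>r 0 = p0\<close>\<close>)
    qed
    \<comment> \<open>The expressions in the quadratic system equal \<open>z 1\<close> and
      \<open>z 2\<close> only under the equations for \<open>v 1\<close> and \<open>v 2\<close>, so
      these rewrites are conditional.\<close>
    have z12: "of_real (u 1) + \<i> / of_real (u 0) * of_real x = z 1" if "v 1 = 1 / u 0 * x" for x
      using z that by simp
    have z22: "of_real (u 2) + \<i> / of_real (u 3) * of_real x = z 2" if "v 2 = 1 / u 3 * x" for x
      using z that by simp
    show ?thesis
      unfolding \<kappa> end_value Let_def complex_eq_iff[symmetric]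
      by (safe; simp only: z12 z22)
  qed
  show ?thesis (is "?L \<longleftrightarrow> ?R")
  proof
    assume L: ?L
    have "d0 = (w 0)\<^sup>2" "d1 = (w 3)\<^sup>2"
      using L ph_curve_has_vector_derivative_iff[OF assms(9)] a
      by (auto simp: preimage_0 preimage_1)
    \<comment> \<open>From \<open>(w 0)\<^sup>2 = q0\<^sup>2\<close> the factor \<open>s\<close> is
      1 or -1. Applied to all coefficients it keeps the squared preimage, hence \<open>r\<close>,
      and normalizes \<open>z 0\<close>; the sign of \<open>z 3\<close> is then no longer
      free.\<close>
    then obtain s :: complex where s: "s * s = 1" "s * w 0 = q0"
      using q0(1) that[of 1] that[of "- 1"] by (auto simp: power2_eq_iff)
    define z where "z k = s * w k" for k
    have z0: "z 0 = q0"
      using s by (simp add: z_def)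
    have "(z 3)\<^sup>2 = q1\<^sup>2"
      using s q1(1) \<open>d1 = (w 3)\<^sup>2\<close>
      by (simp add: z_def power_mult_distrib power2_eq_square[of s])
    then have z3: "z 3 = q1 \<or> z 3 = - q1"
      by (simp only: power2_eq_iff)
    have ph: "ph_curve a z p0 r"
      using assms(9) L s(1) unfolding ph_curve_def z_def preimage_scale
      by (simp add: power_mult_distrib power2_eq_square[of s])
    have "ph_curvature a z 0 = \<kappa>0" "ph_curvature a z 1 = \<kappa>1"
      using ph_curvature_unique[OF ph assms(9) _ preimage_has_vector_derivative_0[OF a] preimage_has_vector_derivative_0[OF a]]
        ph_curvature_unique[OF ph assms(9) _ preimage_has_vector_derivative_1[OF a] preimage_has_vector_derivative_1[OF a]] L
      by auto
    moreover have z: "\<forall>k\<le>3. z k = of_real (Re (z k)) + \<i> * of_real (Im (z k))"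
      by (simp add: complex_eq[symmetric])
    ultimately show ?R
      using data[OF z ph z0 z3] L z0 z3 ph unfolding q0_def[symmetric] q1_def[symmetric]
      by (intro exI[of _ z] exI[of _ "\<lambda>k. Re (z k)"] exI[of _ "\<lambda>k. Im (z k)"]) iprover
  next
    assume ?R
    then obtain z u v where z: "\<forall>k\<le>3. z k = of_real (u k) + \<i> * of_real (v k)"
      and ph: "ph_curve a z p0 r" and z0: "z 0 = q0" and z3: "z 3 = q1 \<or> z 3 = - q1"
      and "r 1 = p1 \<and> ph_curvature a z 0 = \<kappa>0 \<and> ph_curvature a z 1 = \<kappa>1"
      unfolding q0_def[symmetric] q1_def[symmetric] using data by blast
    \<comment> \<open>The coefficients \<open>z\<close> need not be \<open>w\<close>, but both
      generate \<open>r\<close>, so the end curvatures carry over.\<close>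
    moreover have "ph_curvature a w 0 = ph_curvature a z 0" "ph_curvature a w 1 = ph_curvature a z 1"
      using ph_curvature_unique[OF assms(9) ph _ preimage_has_vector_derivative_0[OF a] preimage_has_vector_derivative_0[OF a]]
        ph_curvature_unique[OF assms(9) ph _ preimage_has_vector_derivative_1[OF a] preimage_has_vector_derivative_1[OF a]]
      by auto
    moreover have "d0 = (z 0)\<^sup>2" "d1 = (z 3)\<^sup>2"
      using z0 z3 q0 q1 by auto
    ultimately show ?L
      using ph_curve_has_vector_derivative_iff[OF ph] a
      by (auto simp: preimage_0 preimage_1 ph_curve_def)
  qed
qed

end
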